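(* Every nonmedial $T$-quasigroup is asymmetric.
   Context: A $T$-quasigroup (central quasigroup) is a linear isotope of an abelian group: a quasigroup $(Q;\cdot)$ for which there exist an abelian group $(Q;+)$, automorphisms $\varphi,\psi$ of it and $c\in Q$ with $x\cdot y=\varphi x+c+\psi y$ for all $x,y\in Q$. A quasigroup is medial if it satisfies $xy\cdot uv=xu\cdot yv$. For $\sigma\in S_3$, the $\sigma$-parastrophe of $(\cdot)$ is defined by $x_{1\sigma}\stackrel{\sigma}{\cdot}x_{2\sigma}=x_{3\sigma}\Leftrightarrow x_1\cdot x_2=x_3$, and $\mathrm{Sym}(\cdot)=\{\sigma\in S_3:(\stackrel{\sigma}{\cdot})=(\cdot)\}$. A quasigroup is asymmetric if $\mathrm{Sym}(\cdot)=\{\iota\}$, i.e. its six parastrophes are pairwise different. *)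

theory Defs
  imports "HOL-Algebra.Bij" "HOL-Combinatorics.Permutations"
begin

definition quasigroup :: "'a set \<Rightarrow> ('a \<Rightarrow> 'a \<Rightarrow> 'a) \<Rightarrow> bool" where
  "quasigroup Q f \<longleftrightarrow>
     (\<forall>x\<in>Q. \<forall>y\<in>Q. f x y \<in> Q) \<and>
     (\<forall>a\<in>Q. \<forall>b\<in>Q. \<exists>!x. x \<in> Q \<and> f x a = b) \<and>
     (\<forall>a\<in>Q. \<forall>b\<in>Q. \<exists>!y. y \<in> Q \<and> f a y = b)"

definition T_quasigroup :: "'a set \<Rightarrow> ('a \<Rightarrow> 'a \<Rightarrow> 'a) \<Rightarrow> bool" where
  "T_quasigroup Q f \<longleftrightarrow> quasigroup Q f \<and>
     (\<exists>(G :: 'a monoid) \<phi> \<psi> c.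
        comm_group G \<and> carrier G = Q \<and> \<phi> \<in> auto G \<and> \<psi> \<in> auto G \<and> c \<in> Q \<and>
        (\<forall>x\<in>Q. \<forall>y\<in>Q. f x y = \<phi> x \<otimes>\<^bsub>G\<^esub> c \<otimes>\<^bsub>G\<^esub> \<psi> y))"

definition medial :: "'a set \<Rightarrow> ('a \<Rightarrow> 'a \<Rightarrow> 'a) \<Rightarrow> bool" where
  "medial Q f \<longleftrightarrow>
     (\<forall>x\<in>Q. \<forall>y\<in>Q. \<forall>u\<in>Q. \<forall>v\<in>Q. f (f x y) (f u v) = f (f x u) (f y v))"

text \<open>
  \<open>parastrophe Q f \<sigma>\<close> is only meaningful for a quasigroup \<open>f\<close> on \<open>Q\<close>, a permutation \<open>\<sigma>\<close> of
  \<open>{1, 2, 3}\<close> and arguments in \<open>Q\<close>; lemma \<open>parastrophe_iff\<close> below is its defining equivalence.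
  A triple is represented by a function on the indices 1, 2, 3.
\<close>
definition parastrophe ::
  "'a set \<Rightarrow> ('a \<Rightarrow> 'a \<Rightarrow> 'a) \<Rightarrow> (nat \<Rightarrow> nat) \<Rightarrow> 'a \<Rightarrow> 'a \<Rightarrow> 'a" where
  "parastrophe Q f \<sigma> a b =
     (THE z. z \<in> Q \<and>
        (\<exists>x. x (\<sigma> 1) = a \<and> x (\<sigma> 2) = b \<and> x (\<sigma> 3) = z \<and> f (x 1) (x 2) = x 3))"

text \<open>Two operations on \<open>Q\<close> are equal when they agree on all arguments from \<open>Q\<close>.\<close>
definition Sym :: "'a set \<Rightarrow> ('a \<Rightarrow> 'a \<Rightarrow> 'a) \<Rightarrow> (nat \<Rightarrow> nat) set" where
  "Sym Q f = {\<sigma>. \<sigma> permutes {1, 2, 3} \<and> (\<forall>a\<in>Q. \<forall>b\<in>Q. parastrophe Q f \<sigma> a b = f a b)}"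

definition asymmetric :: "'a set \<Rightarrow> ('a \<Rightarrow> 'a \<Rightarrow> 'a) \<Rightarrow> bool" where
  "asymmetric Q f \<longleftrightarrow> Sym Q f = {id}"

lemma permutes_123_cases:
  assumes "\<sigma> permutes {1, 2, 3 :: nat}"
  shows "(\<sigma> 1, \<sigma> 2, \<sigma> 3) \<in> {(1, 2, 3), (1, 3, 2), (2, 1, 3), (2, 3, 1), (3, 1, 2), (3, 2, 1)}"
proof -
  have "\<sigma> 1 \<in> {1, 2, 3}" "\<sigma> 2 \<in> {1, 2, 3}" "\<sigma> 3 \<in> {1, 2, 3}"
    using permutes_in_image[OF assms] by blast+
  moreover have "\<sigma> 1 \<noteq> \<sigma> 2" "\<sigma> 1 \<noteq> \<sigma> 3" "\<sigma> 2 \<noteq> \<sigma> 3"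
    using permutes_inj[OF assms] by (simp_all add: inj_eq)
  ultimately show ?thesis by (elim insertE emptyE) simp_all
qed

lemma parastrophe_unique:
  assumes Q: "quasigroup Q f" and s: "\<sigma> permutes {1, 2, 3 :: nat}" and ab: "a \<in> Q" "b \<in> Q"
  shows "\<exists>!z. z \<in> Q \<and> (\<exists>x :: nat \<Rightarrow> 'a. x (\<sigma> 1) = a \<and> x (\<sigma> 2) = b \<and> x (\<sigma> 3) = z \<and> f (x 1) (x 2) = x 3)"
proof -
  have ex: "(\<exists>x :: nat \<Rightarrow> 'a. P (x 1) (x 2) (x 3)) \<longleftrightarrow> (\<exists>p q r. P p q r)"
    for P :: "'a \<Rightarrow> 'a \<Rightarrow> 'a \<Rightarrow> bool"
  proof
    assume "\<exists>p q r. P p q r"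
    then obtain p q r where "P p q r" by blast
    then show "\<exists>x :: nat \<Rightarrow> 'a. P (x 1) (x 2) (x 3)"
      by (intro exI[of _ "\<lambda>i. if i = 1 then p else if i = 2 then q else r"]) simp
  qed blast
  have cl: "\<And>x y. x \<in> Q \<Longrightarrow> y \<in> Q \<Longrightarrow> f x y \<in> Q"
    and l: "\<And>a b. a \<in> Q \<Longrightarrow> b \<in> Q \<Longrightarrow> \<exists>!x. x \<in> Q \<and> f x a = b"
    and r: "\<And>a b. a \<in> Q \<Longrightarrow> b \<in> Q \<Longrightarrow> \<exists>!y. y \<in> Q \<and> f a y = b"
    using Q by (simp_all only: quasigroup_def)
  consider "\<sigma> 1 = 1" "\<sigma> 2 = 2" "\<sigma> 3 = 3" | "\<sigma> 1 = 1" "\<sigma> 2 = 3" "\<sigma> 3 = 2"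
    | "\<sigma> 1 = 2" "\<sigma> 2 = 1" "\<sigma> 3 = 3" | "\<sigma> 1 = 2" "\<sigma> 2 = 3" "\<sigma> 3 = 1"
    | "\<sigma> 1 = 3" "\<sigma> 2 = 1" "\<sigma> 3 = 2" | "\<sigma> 1 = 3" "\<sigma> 2 = 2" "\<sigma> 3 = 1"
    using permutes_123_cases[OF s] by (simp only: insert_iff empty_iff prod.inject) metis
  then show ?thesis
  proof cases
    case 1
    have eq: "(\<exists>x. x (\<sigma> 1) = a \<and> x (\<sigma> 2) = b \<and> x (\<sigma> 3) = z \<and> f (x 1) (x 2) = x 3) \<longleftrightarrow> f a b = z" for z
      unfolding 1 by (rule trans[OF ex[of "\<lambda>p q r. p = a \<and> q = b \<and> r = z \<and> f p q = r"]]) simp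
    show ?thesis unfolding eq using cl[OF ab] by blast
  next
    case 2
    have eq: "(\<exists>x. x (\<sigma> 1) = a \<and> x (\<sigma> 2) = b \<and> x (\<sigma> 3) = z \<and> f (x 1) (x 2) = x 3) \<longleftrightarrow> f a z = b" for z
      unfolding 2 by (rule trans[OF ex[of "\<lambda>p q r. p = a \<and> r = b \<and> q = z \<and> f p q = r"]]) simp
    show ?thesis unfolding eq by (rule r[OF ab])
  next
    case 3
    have eq: "(\<exists>x. x (\<sigma> 1) = a \<and> x (\<sigma> 2) = b \<and> x (\<sigma> 3) = z \<and> f (x 1) (x 2) = x 3) \<longleftrightarrow> f b a = z" for z
      unfolding 3 by (rule trans[OF ex[of "\<lambda>p q r. q = a \<and> p = b \<and> r = z \<and> f p q = r"]]) simp
    show ?thesis unfolding eq using cl[OF ab(2,1)] by blast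
  next
    case 4
    have eq: "(\<exists>x. x (\<sigma> 1) = a \<and> x (\<sigma> 2) = b \<and> x (\<sigma> 3) = z \<and> f (x 1) (x 2) = x 3) \<longleftrightarrow> f z a = b" for z
      unfolding 4 by (rule trans[OF ex[of "\<lambda>p q r. q = a \<and> r = b \<and> p = z \<and> f p q = r"]]) simp
    show ?thesis unfolding eq by (rule l[OF ab])
  next
    case 5
    have eq: "(\<exists>x. x (\<sigma> 1) = a \<and> x (\<sigma> 2) = b \<and> x (\<sigma> 3) = z \<and> f (x 1) (x 2) = x 3) \<longleftrightarrow> f b z = a" for z
      unfolding 5 by (rule trans[OF ex[of "\<lambda>p q r. r = a \<and> p = b \<and> q = z \<and> f p q = r"]]) simp
    show ?thesis unfolding eq by (rule r[OF ab(2,1)])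
  next
    case 6
    have eq: "(\<exists>x. x (\<sigma> 1) = a \<and> x (\<sigma> 2) = b \<and> x (\<sigma> 3) = z \<and> f (x 1) (x 2) = x 3) \<longleftrightarrow> f z b = a" for z
      unfolding 6 by (rule trans[OF ex[of "\<lambda>p q r. r = a \<and> q = b \<and> p = z \<and> f p q = r"]]) simp
    show ?thesis unfolding eq by (rule l[OF ab(2,1)])
  qed
qed

lemma parastrophe_iff:
  assumes Q: "quasigroup Q f" and s: "\<sigma> permutes {1, 2, 3}"
    and x: "x 1 \<in> Q" "x 2 \<in> Q" "x 3 \<in> Q"
  shows "parastrophe Q f \<sigma> (x (\<sigma> 1)) (x (\<sigma> 2)) = x (\<sigma> 3) \<longleftrightarrow> f (x 1) (x 2) = x 3"
proof -
  have in_Q: "x (\<sigma> 1) \<in> Q" "x (\<sigma> 2) \<in> Q" "x (\<sigma> 3) \<in> Q"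
    using permutes_123_cases[OF s] x by auto
  note un = parastrophe_unique[OF Q s in_Q(1,2)]
  show ?thesis
  proof
    assume "f (x 1) (x 2) = x 3"
    then show "parastrophe Q f \<sigma> (x (\<sigma> 1)) (x (\<sigma> 2)) = x (\<sigma> 3)"
      unfolding parastrophe_def using in_Q by (intro the1_equality[OF un]) blast
  next
    assume *: "parastrophe Q f \<sigma> (x (\<sigma> 1)) (x (\<sigma> 2)) = x (\<sigma> 3)"
    obtain y where y: "y (\<sigma> 1) = x (\<sigma> 1)" "y (\<sigma> 2) = x (\<sigma> 2)" "y (\<sigma> 3) = x (\<sigma> 3)"
      and fy: "f (y 1) (y 2) = y 3"
      using theI'[OF un] * unfolding parastrophe_def by metis
    have "y 1 = x 1" "y 2 = x 2" "y 3 = x 3"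
      using permutes_123_cases[OF s] y by auto
    with fy show "f (x 1) (x 2) = x 3" by simp
  qed
qed

end

theory Submission
  imports Defs
begin

text \<open>
  If \<open>\<phi>\<close> and \<open>\<psi>\<close> commute, then \<open>x \<cdot> y = \<phi> x + c + \<psi> y\<close> is medial.
  A nontrivial symmetry turns into a functional identity for the operation (such as
  \<open>x \<cdot> (x \<cdot> y) = y\<close>); comparing linear parts gives \<open>\<phi> = \<psi>\<close>, \<open>\<psi> = - 1\<close>, \<open>\<phi> = - 1\<close> or
  \<open>\<phi> \<psi> = 1\<close>, and in each case \<open>\<phi>\<close> and \<open>\<psi>\<close> commute.
\<close>

locale group_linear_isotope = comm_group G for G :: "'a monoid" (structure) +
  fixes \<phi> \<psi> :: "'a \<Rightarrow> 'a" and c :: 'a and f :: "'a \<Rightarrow> 'a \<Rightarrow> 'a"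
  assumes phi: "\<phi> \<in> auto G" and psi: "\<psi> \<in> auto G" and c [simp]: "c \<in> carrier G"
    and f: "\<lbrakk>x \<in> carrier G; y \<in> carrier G\<rbrakk> \<Longrightarrow> f x y = \<phi> x \<otimes> c \<otimes> \<psi> y"
begin

lemma phi_hom: "\<phi> \<in> hom G G" and psi_hom: "\<psi> \<in> hom G G"
  and phi_bij: "bij_betw \<phi> (carrier G) (carrier G)"
  and psi_bij: "bij_betw \<psi> (carrier G) (carrier G)"
  using phi psi by (auto simp: auto_def Bij_def)

sublocale phi: group_hom G G \<phi>
  by (unfold_locales) (rule phi_hom)

sublocale psi: group_hom G G \<psi>
  by (unfold_locales) (rule psi_hom)

lemma f_closed [simp]: "\<lbrakk>x \<in> carrier G; y \<in> carrier G\<rbrakk> \<Longrightarrow> f x y \<in> carrier G"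
  by (simp add: f)

text \<open>Both sides of the medial law expand to the same terms in \<open>x\<close>,
  \<open>v\<close> and \<open>c\<close>. They differ only in whether \<open>y\<close> and
  \<open>u\<close> are hit by \<open>\<phi> \<psi>\<close> or by
  \<open>\<psi> \<phi>\<close>.\<close>

lemma medial_if_commute:
  assumes "\<And>x. x \<in> carrier G \<Longrightarrow> \<phi> (\<psi> x) = \<psi> (\<phi> x)"
  shows "medial (carrier G) f"
  unfolding medial_def by (simp add: f assms m_ac)

lemma phi_cases:
  assumes "y \<in> carrier G" obtains x where "x \<in> carrier G" "y = \<phi> x"
  using assms phi_bij by (auto simp: bij_betw_def)

lemma psi_cases:
  assumes "y \<in> carrier G" obtains x where "x \<in> carrier G" "y = \<psi> x"
  using assms psi_bij by (auto simp: bij_betw_def)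

text \<open>Putting the neutral element for one argument and cancelling \<open>c\<close> leaves
  \<open>\<phi> = \<psi>\<close>.\<close>

lemma commute_if_commutative:
  assumes id: "\<And>x y. \<lbrakk>x \<in> carrier G; y \<in> carrier G\<rbrakk> \<Longrightarrow> f y x = f x y" and x: "x \<in> carrier G"
  shows "\<phi> (\<psi> x) = \<psi> (\<phi> x)"
proof -
  have "\<phi> z = \<psi> z" if "z \<in> carrier G" for z
    using id[of \<one> z] that by (simp add: f m_comm)
  then show ?thesis using x by simp
qed

text \<open>The identity forces \<open>\<psi>\<close> to be inversion, and inversion commutes with
  every endomorphism.\<close>

lemma commute_if_left_symmetric:
  assumes id: "\<And>x y. \<lbrakk>x \<in> carrier G; y \<in> carrier G\<rbrakk> \<Longrightarrow> f x (f x y) = y" and x: "x \<in> carrier G"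
  shows "\<phi> (\<psi> x) = \<psi> (\<phi> x)"
proof -
  \<comment> \<open>This is the constant part of the identity; once it is trivial, only the linear
    parts remain to be compared.\<close>
  have c0: "c \<otimes> \<psi> c = \<one>"
    using id[of \<one> \<one>] by (simp add: f)
  have "\<psi> (\<phi> z) = inv (\<phi> z)" if z: "z \<in> carrier G" for z
  proof -
    have "\<psi> (\<phi> z) \<otimes> \<phi> z = \<psi> (\<phi> z) \<otimes> \<phi> z \<otimes> (c \<otimes> \<psi> c)"
      using z by (simp add: c0)
    also have "\<dots> = f z (f z \<one>)"
      using z by (simp add: f m_ac)
    finally show ?thesis using z by (simp add: id inv_equality)
  qed
  \<comment> \<open>Surjectivity of \<open>\<phi>\<close> extends the formula from the values
    \<open>\<phi> z\<close> to the whole group.\<close>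
  then have "\<psi> y = inv y" if "y \<in> carrier G" for y
    using that by (metis phi_cases)
  then show ?thesis using x by simp
qed

text \<open>Mirror image of the left-symmetric case: now \<open>\<phi>\<close> is inversion, by
  surjectivity of \<open>\<psi>\<close>.\<close>

lemma commute_if_right_symmetric:
  assumes id: "\<And>x y. \<lbrakk>x \<in> carrier G; y \<in> carrier G\<rbrakk> \<Longrightarrow> f (f x y) y = x" and x: "x \<in> carrier G"
  shows "\<phi> (\<psi> x) = \<psi> (\<phi> x)"
proof -
  have c0: "\<phi> c \<otimes> c = \<one>"
    using id[of \<one> \<one>] by (simp add: f)
  have "\<phi> (\<psi> z) = inv (\<psi> z)" if z: "z \<in> carrier G" for z
  proof -
    have "\<phi> (\<psi> z) \<otimes> \<psi> z = \<phi> (\<psi> z) \<otimes> \<psi> z \<otimes> (\<phi> c \<otimes> c)"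
      using z by (simp add: c0)
    also have "\<dots> = f (f \<one> z) z"
      using z by (simp add: f m_ac)
    finally show ?thesis using z by (simp add: id inv_equality)
  qed
  then have "\<phi> y = inv y" if "y \<in> carrier G" for y
    using that by (metis psi_cases)
  then show ?thesis using x by simp
qed

text \<open>Comparing linear parts makes \<open>\<psi>\<close> a left inverse of
  \<open>\<phi>\<close>; since \<open>\<phi>\<close> is onto, it is a two-sided inverse.\<close>

lemma commute_if_semisymmetric:
  assumes id: "\<And>x y. \<lbrakk>x \<in> carrier G; y \<in> carrier G\<rbrakk> \<Longrightarrow> f y (f x y) = x" and x: "x \<in> carrier G"
  shows "\<phi> (\<psi> x) = \<psi> (\<phi> x)"
proof -
  have c0: "c \<otimes> \<psi> c = \<one>"
    using id[of \<one> \<one>] by (simp add: f)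
  have inverse: "\<psi> (\<phi> z) = z" if z: "z \<in> carrier G" for z
  proof -
    have "\<psi> (\<phi> z) = \<psi> (\<phi> z) \<otimes> (c \<otimes> \<psi> c)"
      using z by (simp add: c0)
    also have "\<dots> = f \<one> (f z \<one>)"
      using z by (simp add: f m_ac)
    finally show ?thesis using z by (simp add: id)
  qed
  obtain y where "y \<in> carrier G" "x = \<phi> y" using x by (rule phi_cases)
  then show ?thesis using inverse x by simp
qed

lemma medial_if_nontrivial_Sym:
  assumes Q: "quasigroup (carrier G) f" and s: "\<sigma> \<in> Sym (carrier G) f" and "\<sigma> \<noteq> id"
  shows "medial (carrier G) f"
proof -
  have p: "\<sigma> permutes {1, 2, 3}"
    and par: "\<And>a b. \<lbrakk>a \<in> carrier G; b \<in> carrier G\<rbrakk> \<Longrightarrow> parastrophe (carrier G) f \<sigma> a b = f a b"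
    using s by (auto simp: Sym_def)
  \<comment> \<open>\<open>t\<close> encodes the triple \<open>(x, y, f x y)\<close>. A symmetry
    sends each such triple to another one, so each \<open>\<sigma>\<close> yields an identity for
    \<open>f\<close>.\<close>
  have symm: "f (t (\<sigma> 1)) (t (\<sigma> 2)) = t (\<sigma> 3)"
    if xy: "x \<in> carrier G" "y \<in> carrier G"
      and t: "t = (\<lambda>i. if i = 1 then x else if i = 2 then y else f x y)" for x y t
  proof -
    have in_Q: "t i \<in> carrier G" for i using xy t by simp
    have "f (t 1) (t 2) = t 3" using t by simp
    then have "parastrophe (carrier G) f \<sigma> (t (\<sigma> 1)) (t (\<sigma> 2)) = t (\<sigma> 3)"
      by (rule parastrophe_iff[OF Q p in_Q in_Q in_Q, THEN iffD2])
    then show ?thesis by (simp only: par[OF in_Q in_Q])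
  qed
  \<comment> \<open>A permutation of \<open>{1, 2, 3}\<close> fixes every other number, so differing
    from \<open>id\<close> must show on these three indices.\<close>
  have not_id: "\<not> (\<sigma> 1 = 1 \<and> \<sigma> 2 = 2 \<and> \<sigma> 3 = 3)"
  proof
    assume "\<sigma> 1 = 1 \<and> \<sigma> 2 = 2 \<and> \<sigma> 3 = 3"
    then have "\<sigma> i = i" for i
      using permutes_not_in[OF p, of i] by (cases "i \<in> {1, 2, 3}") auto
    then show False using \<open>\<sigma> \<noteq> id\<close> by auto
  qed
  \<comment> \<open>With \<open>f\<close> written as juxtaposition, the five cases give in order
    \<open>x(xy) = y\<close>, \<open>yx = xy\<close>, \<open>y(xy) = x\<close>,
    \<open>(xy)x = y\<close> and \<open>(xy)y = x\<close>.\<close>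
  consider "\<sigma> 1 = 1" "\<sigma> 2 = 3" "\<sigma> 3 = 2" | "\<sigma> 1 = 2" "\<sigma> 2 = 1" "\<sigma> 3 = 3"
    | "\<sigma> 1 = 2" "\<sigma> 2 = 3" "\<sigma> 3 = 1" | "\<sigma> 1 = 3" "\<sigma> 2 = 1" "\<sigma> 3 = 2"
    | "\<sigma> 1 = 3" "\<sigma> 2 = 2" "\<sigma> 3 = 1"
    using permutes_123_cases[OF p] not_id by (simp only: insert_iff empty_iff prod.inject) metis
  then have "\<phi> (\<psi> x) = \<psi> (\<phi> x)" if x: "x \<in> carrier G" for x
  proof cases
    case 1
    show ?thesis using symm[OF _ _ refl] unfolding 1 by (intro commute_if_left_symmetric x) simp
  next
    case 2
    show ?thesis using symm[OF _ _ refl] unfolding 2 by (intro commute_if_commutative x) simp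
  next
    case 3
    show ?thesis using symm[OF _ _ refl] unfolding 3 by (intro commute_if_semisymmetric x) simp
  next
    case 4
    have *: "f (f x y) x = y" if "x \<in> carrier G" "y \<in> carrier G" for x y
      using symm[OF that refl] unfolding 4 by simp
    \<comment> \<open>Both 3-cycles give the same law, since \<open>(x y) x = y\<close> makes \<open>y (x y)\<close> equal to \<open>((x y) x) (x y)\<close>.\<close>
    have "f y (f x y) = x" if "x \<in> carrier G" "y \<in> carrier G" for x y
      using *[of "f x y" x] *[of x y] that by simp
    then show ?thesis by (intro commute_if_semisymmetric x)
  next
    case 5
    show ?thesis using symm[OF _ _ refl] unfolding 5 by (intro commute_if_right_symmetric x) simp
  qed
  then show ?thesis by (rule medial_if_commute)
qed

end

text \<open>Supplies the inclusion of \<open>{id}\<close> in \<open>Sym Q f\<close>, which asymmetry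
  demands besides the absence of other symmetries.\<close>

lemma id_in_Sym:
  assumes "quasigroup Q f"
  shows "id \<in> Sym Q f"
proof -
  have "parastrophe Q f id a b = f a b" if ab: "a \<in> Q" "b \<in> Q" for a b
  proof -
    have "f a b \<in> Q" using assms ab by (simp add: quasigroup_def)
    then show ?thesis
      using parastrophe_iff[OF assms permutes_id,
          of "\<lambda>i. if i = 1 then a else if i = 2 then b else f a b"] ab by simp
  qed
  then show ?thesis by (simp add: Sym_def permutes_id)
qed

theorem corollary14:
  fixes Q :: "'a set" and f :: "'a \<Rightarrow> 'a \<Rightarrow> 'a"
  assumes "T_quasigroup Q f" and "\<not> medial Q f"
  shows "asymmetric Q f"
proof -
  obtain G :: "'a monoid" and \<phi> \<psi> c where Q: "quasigroup Q f" and G: "comm_group G" "carrier G = Q"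
    and "\<phi> \<in> auto G" "\<psi> \<in> auto G" "c \<in> Q"
    and "\<forall>x\<in>Q. \<forall>y\<in>Q. f x y = \<phi> x \<otimes>\<^bsub>G\<^esub> c \<otimes>\<^bsub>G\<^esub> \<psi> y"
    using assms(1) unfolding T_quasigroup_def by blast
  then interpret group_linear_isotope G \<phi> \<psi> c f
    by (intro group_linear_isotope.intro group_linear_isotope_axioms.intro) auto
  have "\<sigma> = id" if "\<sigma> \<in> Sym Q f" for \<sigma>
    using medial_if_nontrivial_Sym[of \<sigma>] that Q G assms(2) by auto
  then show ?thesis
    using id_in_Sym[OF Q] by (auto simp: asymmetric_def)
qed

end
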